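(* For each positive integer $d\ge 1$ there exists a bipartite, connected, nontraceable detour graph with detour deficiency at least $d$.
   Context: All graphs are finite and simple; the order of a path is its number of vertices. For a vertex $v$, $\tau(v)$ is the order of a longest path in the graph having $v$ as an endvertex, and $\tau(G)$ is the order of a longest path in $G$. A detour graph is one in which all vertices have the same $\tau(v)$. Nontraceable means having no hamiltonian path. The detour deficiency of $G$ is $|V(G)|-\tau(G)$. *)

theory Defs
  imports Main
begin

definition simple_graph :: "'a set \<Rightarrow> ('a \<Rightarrow> 'a \<Rightarrow> bool) \<Rightarrow> bool" where
  "simple_graph V E \<longleftrightarrow> finite V \<and> (\<forall>u v. E u v \<longrightarrow> u \<in> V \<and> v \<in> V)
     \<and> (\<forall>u v. E u v \<longrightarrow> E v u) \<and> (\<forall>v. \<not> E v v)"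

definition is_path :: "'a set \<Rightarrow> ('a \<Rightarrow> 'a \<Rightarrow> bool) \<Rightarrow> 'a list \<Rightarrow> bool" where
  "is_path V E p \<longleftrightarrow> p \<noteq> [] \<and> distinct p \<and> set p \<subseteq> V
     \<and> (\<forall>i. Suc i < length p \<longrightarrow> E (p ! i) (p ! Suc i))"

definition tau_v :: "'a set \<Rightarrow> ('a \<Rightarrow> 'a \<Rightarrow> bool) \<Rightarrow> 'a \<Rightarrow> nat" where
  "tau_v V E v = Max {length p | p. is_path V E p \<and> hd p = v}"

definition tau_G :: "'a set \<Rightarrow> ('a \<Rightarrow> 'a \<Rightarrow> bool) \<Rightarrow> nat" where
  "tau_G V E = Max {length p | p. is_path V E p}"

definition detour_graph :: "'a set \<Rightarrow> ('a \<Rightarrow> 'a \<Rightarrow> bool) \<Rightarrow> bool" where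
  "detour_graph V E \<longleftrightarrow> (\<forall>u\<in>V. \<forall>v\<in>V. tau_v V E u = tau_v V E v)"

definition traceable :: "'a set \<Rightarrow> ('a \<Rightarrow> 'a \<Rightarrow> bool) \<Rightarrow> bool" where
  "traceable V E \<longleftrightarrow> (\<exists>p. is_path V E p \<and> set p = V)"

definition connected_graph :: "'a set \<Rightarrow> ('a \<Rightarrow> 'a \<Rightarrow> bool) \<Rightarrow> bool" where
  "connected_graph V E \<longleftrightarrow> V \<noteq> {} \<and>
     (\<forall>u\<in>V. \<forall>v\<in>V. \<exists>p. is_path V E p \<and> hd p = u \<and> last p = v)"

definition bipartite :: "'a set \<Rightarrow> ('a \<Rightarrow> 'a \<Rightarrow> bool) \<Rightarrow> bool" where
  "bipartite V E \<longleftrightarrow> (\<exists>A B. A \<inter> B = {} \<and> A \<union> B = V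
     \<and> (\<forall>u v. E u v \<longrightarrow> (u \<in> A \<and> v \<in> B) \<or> (u \<in> B \<and> v \<in> A)))"

definition detour_deficiency :: "'a set \<Rightarrow> ('a \<Rightarrow> 'a \<Rightarrow> bool) \<Rightarrow> nat" where
  "detour_deficiency V E = card V - tau_G V E"

end

theory Submission
  imports Defs "HOL-Library.Countable"
begin

text \<open>
  Take the cube graph and replace every vertex by a directed triangle, one node for each incident
  edge (direction \<open>axis\<close>), where the two nodes belonging to an edge are joined by a 2-cycle. A dipath
  that enters and leaves a triangle must traverse all of it in order to cover it, hence always
  takes the same turn and closes up after six triangles. So this digraph, which has 24 nodes, has no
  spanning dipath; by a finite check this remains true if the first and the last node are exempt
  from all conditions.

  Now blow up every node to a complete bipartite graph with classes of size \<open>n\<close>, where only one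
  vertex of each class is incident with edges that come from arcs. A path of the resulting
  bipartite graph that met the rest of every blown-up node would induce a spanning dipath. Hence
  every path misses at least \<open>2 * (n - 1)\<close> vertices.

  The digraph is vertex-transitive and isomorphic to its reverse. Up to symmetry the blow-up
  therefore has only two kinds of vertices, and Posa rotation produces longest paths that start in
  either kind. So it is a detour graph, although its detour order is never computed.
\<close>

section \<open>Longest paths\<close>

lemma is_path_iff:
  "is_path V E p \<longleftrightarrow> p \<noteq> [] \<and> distinct p \<and> set p \<subseteq> V \<and> successively E p"
  by (simp add: is_path_def successively_conv_nth)

lemma is_path_bij:
  assumes "bij_betw f V V" "\<And>x y. x \<in> V \<Longrightarrow> y \<in> V \<Longrightarrow> E x y \<Longrightarrow> E (f x) (f y)" "is_path V E p"
  shows "is_path V E (map f p)"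
proof -
  have p: "p \<noteq> []" "distinct p" "set p \<subseteq> V" "successively E p"
    using assms(3) by (auto simp: is_path_iff)
  have "successively (\<lambda>x y. E (f x) (f y)) p"
    using p(4) by (rule successively_mono) (use p(3) assms(2) in auto)
  moreover have "inj_on f (set p)" "f ` set p \<subseteq> V"
    using assms(1) p(3) by (auto simp: bij_betw_def intro: inj_on_subset)
  ultimately show ?thesis
    using p by (auto simp: is_path_iff successively_map distinct_map)
qed

definition longest_path :: "'a set \<Rightarrow> ('a \<Rightarrow> 'a \<Rightarrow> bool) \<Rightarrow> 'a list \<Rightarrow> bool" where
  "longest_path V E p \<longleftrightarrow> is_path V E p \<and> (\<forall>q. is_path V E q \<longrightarrow> length q \<le> length p)"

definition starts_longest :: "'a set \<Rightarrow> ('a \<Rightarrow> 'a \<Rightarrow> bool) \<Rightarrow> 'a \<Rightarrow> bool" where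
  "starts_longest V E x \<longleftrightarrow> (\<exists>p. longest_path V E p \<and> hd p = x)"

lemma path_lengths_finite: "finite V \<Longrightarrow> finite {length p |p. is_path V E p \<and> Q p}"
  by (rule finite_subset[of _ "{..card V}"]) (auto simp: is_path_iff distinct_card[symmetric] intro: card_mono)

lemma longest_path_exists:
  assumes "finite V" "V \<noteq> {}"
  obtains p where "longest_path V E p"
proof -
  obtain x where "x \<in> V" using assms(2) by blast
  then have "is_path V E [x]" by (simp add: is_path_iff)
  then obtain p where "is_path V E p" "\<forall>q. is_path V E q \<longrightarrow> length q \<le> length p"
    using ex_has_greatest_nat[of "is_path V E" "[x]" length "Suc (card V)"] assms(1)
    by (metis card_mono distinct_card is_path_iff less_Suc_eq_le)
  then show ?thesis using that by (auto simp: longest_path_def)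
qed

lemma tau_v_eq_longest:
  assumes "finite V" "longest_path V E p"
  shows "tau_v V E (hd p) = length p"
  unfolding tau_v_def
  using assms path_lengths_finite[OF assms(1), of E "\<lambda>q. hd q = hd p"]
  by (intro Max_eqI) (auto simp: longest_path_def)

lemma tau_G_eq_longest:
  assumes "finite V" "longest_path V E p"
  shows "tau_G V E = length p"
  unfolding tau_G_def
  using assms path_lengths_finite[OF assms(1), of E "\<lambda>_. True"]
  by (intro Max_eqI) (auto simp: longest_path_def)

text \<open>Any two longest paths have equal length; this settles the detour property without
  determining that length.\<close>

lemma detour_graph_if_all_start:
  assumes "finite V" "\<And>v. v \<in> V \<Longrightarrow> starts_longest V E v"
  shows "detour_graph V E"
proof -
  have "tau_v V E (hd p) = tau_v V E (hd q)" if "longest_path V E p" "longest_path V E q" for p q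
    using that tau_v_eq_longest[OF assms(1)] by (metis le_antisym longest_path_def)
  then show ?thesis
    using assms(2) unfolding detour_graph_def starts_longest_def by metis
qed

lemma starts_longest_bij:
  assumes "bij_betw f V V" "\<And>x y. x \<in> V \<Longrightarrow> y \<in> V \<Longrightarrow> E x y \<Longrightarrow> E (f x) (f y)"
    and "starts_longest V E x"
  shows "starts_longest V E (f x)"
proof -
  obtain p where p: "longest_path V E p" "hd p = x"
    using assms(3) by (auto simp: starts_longest_def)
  have "is_path V E (map f p)"
    using is_path_bij[of f V E p] assms(1,2) p(1) by (auto simp: longest_path_def)
  then have "longest_path V E (map f p)"
    using p(1) by (simp add: longest_path_def)
  moreover have "hd (map f p) = f x"
    using p by (simp add: longest_path_def is_path_iff hd_map)
  ultimately show ?thesis by (auto simp: starts_longest_def)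
qed

text \<open>Posa rotation: reversing the part of a longest path before a neighbour \<open>y\<close> of its first
  vertex turns the predecessor of \<open>y\<close> into the first vertex of a longest path.\<close>

lemma rotation:
  assumes G: "simple_graph V E" and x: "starts_longest V E x"
  obtains f where "inj_on f {y. E x y}"
    "\<And>y. E x y \<Longrightarrow> starts_longest V E (f y) \<and> E (f y) y"
proof -
  obtain p where p: "longest_path V E p" "hd p = x"
    using x by (auto simp: starts_longest_def)
  then have path: "p \<noteq> []" "distinct p" "set p \<subseteq> V" "successively E p"
    by (auto simp: longest_path_def is_path_iff)
  have sym: "E u v \<Longrightarrow> E v u" and irr: "\<not> E u u" and inV: "E u v \<Longrightarrow> u \<in> V" for u v
    using G by (auto simp: simple_graph_def)
  have on: "y \<in> set p" if "E x y" for y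
  proof (rule ccontr)
    assume "y \<notin> set p"
    then have "is_path V E (y # p)"
      using that path p(2) sym[of x y] inV[of y x] by (auto simp: is_path_iff successively_Cons)
    then show False using p(1) by (fastforce simp: longest_path_def)
  qed
  have "\<exists>k. Suc k < length p \<and> p ! Suc k = y" if "E x y" for y
  proof -
    obtain k where k: "k < length p" "p ! k = y" using on[OF \<open>E x y\<close>] by (metis in_set_conv_nth)
    have "k \<noteq> 0" using k p(2) path(1) that irr by (metis hd_conv_nth)
    then show ?thesis using k by (cases k) auto
  qed
  then obtain k where k: "\<And>y. E x y \<Longrightarrow> Suc (k y) < length p \<and> p ! Suc (k y) = y"
    by metis
  show ?thesis
  proof (rule that[of "\<lambda>y. p ! k y"])
    show "inj_on (\<lambda>y. p ! k y) {y. E x y}"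
      using k path(2) by (auto simp: inj_on_def) (metis Suc_lessD nth_eq_iff_index_eq)
    fix y assume y: "E x y"
    define xs ys where "xs = take (Suc (k y)) p" and "ys = drop (Suc (k y)) p"
    have pxy: "p = xs @ ys" by (simp add: xs_def ys_def)
    have xs: "xs \<noteq> []" "hd xs = x" "last xs = p ! k y"
      using path(1) p(2) k[OF y] by (simp_all add: xs_def) (simp add: take_Suc_conv_app_nth)
    have ys: "ys \<noteq> []" "hd ys = y"
      using k[OF y] by (auto simp: ys_def hd_drop_conv_nth)
    have s: "successively E xs" "successively E ys"
      using path(4) by (auto simp: pxy successively_append_iff)
    have "successively E (rev xs)"
      unfolding successively_rev using s(1) by (rule successively_mono) (rule sym)
    then have "successively E (rev xs @ ys)"
      using s(2) xs ys y by (auto simp: successively_append_iff last_rev)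
    then have "is_path V E (rev xs @ ys)"
      using path xs by (auto simp: is_path_iff pxy)
    then have "longest_path V E (rev xs @ ys)"
      using p(1) by (simp add: longest_path_def pxy)
    moreover have "hd (rev xs @ ys) = p ! k y"
      using xs by (simp add: hd_rev)
    moreover have "E (p ! k y) y"
      using successively_nth[OF path(4)] k[OF y] by metis
    ultimately show "starts_longest V E (p ! k y) \<and> E (p ! k y) y"
      by (auto simp: starts_longest_def)
  qed
qed

text \<open>Closedness is applied to the set of end vertices of paths from \<open>u\<close>: a
  neighbour of such an end vertex is either appended to the path or already on it, and then the path
  is cut there.\<close>

lemma connected_graphI:
  assumes "V \<noteq> {}" and sym: "\<And>x y. E x y \<Longrightarrow> E y x" and inV: "\<And>x y. E x y \<Longrightarrow> y \<in> V"
    and reach: "\<And>S. S \<subseteq> V \<Longrightarrow> S \<noteq> {} \<Longrightarrow> (\<And>x y. x \<in> S \<Longrightarrow> E x y \<Longrightarrow> y \<in> S) \<Longrightarrow> S = V"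
  shows "connected_graph V E"
proof -
  have "\<exists>p. is_path V E p \<and> hd p = u \<and> last p = v" if u: "u \<in> V" and v: "v \<in> V" for u v
  proof -
    define S where "S = {last p |p. is_path V E p \<and> hd p = u}"
    have "S = V"
    proof (rule reach)
      show "S \<subseteq> V" by (auto simp: S_def is_path_iff)
      have "is_path V E [u]" using u by (simp add: is_path_iff)
      then have "u \<in> S" unfolding S_def by (intro CollectI exI[of _ "[u]"]) simp
      then show "S \<noteq> {}" by blast
      fix x y assume "x \<in> S" "E x y"
      then obtain p where p: "is_path V E p" "hd p = u" "last p = x" by (auto simp: S_def)
      show "y \<in> S"
      proof (cases "y \<in> set p")
        case True
        then obtain xs ys where xy: "p = xs @ y # ys" by (meson split_list)
        then have "is_path V E (xs @ [y])" "hd (xs @ [y]) = u"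
          using p by (auto simp: is_path_iff successively_append_iff hd_append)
        then show ?thesis unfolding S_def by (intro CollectI exI[of _ "xs @ [y]"]) simp
      next
        case False
        then have "is_path V E (p @ [y])" "hd (p @ [y]) = u"
          using p \<open>E x y\<close> inV by (auto simp: is_path_iff successively_append_iff)
        then show ?thesis unfolding S_def by (intro CollectI exI[of _ "p @ [y]"]) simp
      qed
    qed
    with v have "v \<in> S" by simp
    then show ?thesis unfolding S_def by blast
  qed
  then show ?thesis using assms(1) by (auto simp: connected_graph_def)
qed

section \<open>Edges traversed by a path\<close>

definition uses_edge :: "'a list \<Rightarrow> 'a \<Rightarrow> 'a \<Rightarrow> bool" where
  "uses_edge p x y \<longleftrightarrow>
     (\<exists>i. Suc i < length p \<and> (p ! i = x \<and> p ! Suc i = y \<or> p ! i = y \<and> p ! Suc i = x))"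

lemma uses_edge_sym: "uses_edge p x y \<longleftrightarrow> uses_edge p y x"
  by (auto simp: uses_edge_def)

lemma uses_edge_nth:
  assumes "distinct p" "i < length p"
  shows "uses_edge p (p ! i) y \<longleftrightarrow> 0 < i \<and> y = p ! (i - 1) \<or> Suc i < length p \<and> y = p ! Suc i"
proof
  assume "uses_edge p (p ! i) y"
  then obtain j where j: "Suc j < length p"
    "p ! j = p ! i \<and> p ! Suc j = y \<or> p ! j = y \<and> p ! Suc j = p ! i"
    by (auto simp: uses_edge_def)
  then have "j = i \<and> p ! Suc j = y \<or> p ! j = y \<and> Suc j = i"
    using assms by (metis Suc_lessD nth_eq_iff_index_eq)
  then show "0 < i \<and> y = p ! (i - 1) \<or> Suc i < length p \<and> y = p ! Suc i"
    using j(1) by auto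
next
  assume "0 < i \<and> y = p ! (i - 1) \<or> Suc i < length p \<and> y = p ! Suc i"
  then show "uses_edge p (p ! i) y"
    unfolding uses_edge_def using assms(2) by (metis Suc_diff_1)
qed

lemma uses_edge_adjacent:
  "is_path V E p \<Longrightarrow> simple_graph V E \<Longrightarrow> uses_edge p x y \<Longrightarrow> E x y"
  by (auto simp: is_path_def uses_edge_def simple_graph_def)

text \<open>If no used edge left \<open>S\<close>, membership in \<open>S\<close> would be constant
  along \<open>p\<close>.\<close>

lemma path_leaves_set:
  assumes "p \<noteq> []" "hd p \<notin> S" "x \<in> set p" "x \<in> S"
  obtains y z where "uses_edge p y z" "y \<in> S" "z \<notin> S"
proof (rule ccontr)
  assume "\<not> thesis"
  then have "\<And>y z. uses_edge p y z \<Longrightarrow> y \<in> S \<Longrightarrow> z \<in> S" using that by blast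
  then have *: "p ! i \<in> S \<longleftrightarrow> p ! Suc i \<in> S" if "Suc i < length p" for i
    using that unfolding uses_edge_def by blast
  have "i < length p \<Longrightarrow> p ! i \<notin> S" for i
    using assms(1,2) * by (induction i) (auto simp: hd_conv_nth)
  then show False using assms(3,4) by (auto simp: in_set_conv_nth)
qed

section \<open>Relabelling the vertices\<close>

text \<open>The construction lives on triples, the theorem asks for vertices in \<open>nat\<close>;
  every notion defined through paths is carried over along an injective \<open>f\<close>.\<close>

definition map_edges :: "('a \<Rightarrow> 'b) \<Rightarrow> ('a \<Rightarrow> 'a \<Rightarrow> bool) \<Rightarrow> 'b \<Rightarrow> 'b \<Rightarrow> bool" where
  "map_edges f E x y \<longleftrightarrow> (\<exists>u v. x = f u \<and> y = f v \<and> E u v)"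

context
  fixes f :: "'a \<Rightarrow> 'b" and V :: "'a set" and E :: "'a \<Rightarrow> 'a \<Rightarrow> bool"
  assumes inj: "inj f"
begin

lemma map_edges_iff [simp]: "map_edges f E (f u) (f v) \<longleftrightarrow> E u v"
  using inj by (auto simp: map_edges_def inj_eq)

lemma is_path_map: "is_path (f ` V) (map_edges f E) (map f p) \<longleftrightarrow> is_path V E p"
  using inj inj_on_subset[OF inj]
  by (simp add: is_path_iff successively_map distinct_map inj_image_subset_iff)

lemma is_path_image_iff:
  "is_path (f ` V) (map_edges f E) q \<longleftrightarrow> (\<exists>p. q = map f p \<and> is_path V E p)"
proof
  assume q: "is_path (f ` V) (map_edges f E) q"
  then have "set q \<subseteq> range f" by (auto simp: is_path_iff)
  then obtain p where "q = map f p" by (metis ex_map_conv rangeE subset_iff)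
  then show "\<exists>p. q = map f p \<and> is_path V E p" using q is_path_map by blast
qed (use is_path_map in blast)

lemma simple_graph_image: "simple_graph V E \<Longrightarrow> simple_graph (f ` V) (map_edges f E)"
  using inj unfolding simple_graph_def map_edges_def inj_def by blast

lemma bipartite_image:
  assumes "bipartite V E"
  shows "bipartite (f ` V) (map_edges f E)"
proof -
  obtain A B where "A \<inter> B = {}" "A \<union> B = V"
    "\<forall>u v. E u v \<longrightarrow> u \<in> A \<and> v \<in> B \<or> u \<in> B \<and> v \<in> A"
    using assms by (auto simp: bipartite_def)
  then have "f ` A \<inter> f ` B = {}" "f ` A \<union> f ` B = f ` V"
    "\<forall>u v. map_edges f E u v \<longrightarrow> u \<in> f ` A \<and> v \<in> f ` B \<or> u \<in> f ` B \<and> v \<in> f ` A"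
    using inj unfolding map_edges_def inj_def by blast+
  then show ?thesis unfolding bipartite_def by blast
qed

lemma connected_image: "connected_graph V E \<Longrightarrow> connected_graph (f ` V) (map_edges f E)"
proof -
  assume c: "connected_graph V E"
  have "\<exists>q. is_path (f ` V) (map_edges f E) q \<and> hd q = f u \<and> last q = f v"
    if "u \<in> V" "v \<in> V" for u v
  proof -
    obtain p where p: "is_path V E p" "hd p = u" "last p = v"
      using c \<open>u \<in> V\<close> \<open>v \<in> V\<close> unfolding connected_graph_def by blast
    then have "hd (map f p) = f u" "last (map f p) = f v"
      by (simp_all add: is_path_iff hd_map last_map)
    then show ?thesis using p(1) is_path_map by blast
  qed
  then show ?thesis using c unfolding connected_graph_def by blast
qed

lemma traceable_image: "traceable (f ` V) (map_edges f E) \<Longrightarrow> traceable V E"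
  unfolding traceable_def is_path_image_iff by (elim exE conjE) (use inj in \<open>auto simp: inj_image_eq_iff\<close>)

lemma tau_v_image: "tau_v (f ` V) (map_edges f E) (f v) = tau_v V E v"
proof -
  have "{length q |q. is_path (f ` V) (map_edges f E) q \<and> hd q = f v}
      = {length p |p. is_path V E p \<and> hd p = v}"
  proof (intro set_eqI iffI; clarify)
    fix q assume q: "is_path (f ` V) (map_edges f E) q" "hd q = f v"
    then obtain p where p: "q = map f p" "is_path V E p"
      by (auto simp: is_path_image_iff)
    with q(2) have "f (hd p) = f v" by (simp add: is_path_iff hd_map)
    with p    show "\<exists>p. length q = length p \<and> is_path V E p \<and> hd p = v"
      using inj by (intro exI[of _ p]) (auto simp: inj_eq)
  next
    fix p assume p: "is_path V E p" "v = hd p"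
    then have "f (hd p) = hd (map f p)" by (simp add: is_path_iff hd_map)
    with p show "\<exists>q. length p = length q \<and> is_path (f ` V) (map_edges f E) q \<and> hd q = f (hd p)"
      by (intro exI[of _ "map f p"]) (simp add: is_path_map)
  qed
  then show ?thesis by (simp add: tau_v_def)
qed

lemma detour_graph_image: "detour_graph V E \<Longrightarrow> detour_graph (f ` V) (map_edges f E)"
  unfolding detour_graph_def ball_simps tau_v_image by blast

lemma detour_deficiency_image: "detour_deficiency (f ` V) (map_edges f E) = detour_deficiency V E"
proof -
  have "{length q |q. is_path (f ` V) (map_edges f E) q} = {length p |p. is_path V E p}"
    unfolding is_path_image_iff by (intro set_eqI iffI; clarify) (metis length_map)+
  moreover have "card (f ` V) = card V" using inj by (simp add: card_image inj_on_def)
  ultimately show ?thesis by (simp add: detour_deficiency_def tau_G_def)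
qed

end

section \<open>The digraph\<close>

datatype axis = AX | AY | AZ

instance axis :: countable
  by countable_datatype

text \<open>\<open>Node j p q r\<close> stands for the cube vertex \<open>(p, q, r)\<close> together
  with its incident edge in direction \<open>j\<close>.\<close>

datatype node = Node (axis_of: axis) bool bool bool

instance node :: countable
  by countable_datatype

text \<open>Passes to the other end of the cube edge; \<open>turn\<close> moves around the directed
  triangle of a cube vertex.\<close>

fun cross :: "node \<Rightarrow> node" where
  "cross (Node AX p q r) = Node AX (\<not> p) q r"
| "cross (Node AY p q r) = Node AY p (\<not> q) r"
| "cross (Node AZ p q r) = Node AZ p q (\<not> r)"

fun turn :: "node \<Rightarrow> node" where
  "turn (Node AX p q r) = Node AY p q r"
| "turn (Node AY p q r) = Node AZ p q r"
| "turn (Node AZ p q r) = Node AX p q r"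

definition step :: "bool \<Rightarrow> node \<Rightarrow> node" where
  "step c = (if c then cross else turn)"

lemma step_simps [simp]: "step True = cross" "step False = turn"
  by (simp_all add: step_def)

lemma all_axis: "(\<forall>j. P j) \<longleftrightarrow> P AX \<and> P AY \<and> P AZ"
  by (metis axis.exhaust)

lemma all_node: "(\<forall>u. P u) \<longleftrightarrow> (\<forall>p q r. P (Node AX p q r) \<and> P (Node AY p q r) \<and> P (Node AZ p q r))"
  by (metis axis.exhaust node.exhaust)

lemma cross_cross [simp]: "cross (cross u) = u"
  by (cases u rule: cross.cases) auto

lemma turn_turn_turn [simp]: "turn (turn (turn u)) = u"
  by (cases u rule: turn.cases) auto

lemma cross_neq_turn: "cross u \<noteq> turn u"
  by (cases u rule: cross.cases) auto

lemma step_neq [simp]: "step c u \<noteq> u"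
  by (cases u rule: cross.cases; cases c) auto

definition arc :: "node \<Rightarrow> node \<Rightarrow> bool" where
  "arc u v \<longleftrightarrow> (\<exists>c. v = step c u)"

lemma arc_iff: "arc u v \<longleftrightarrow> v = cross u \<or> v = turn u"
  by (auto simp: arc_def step_def)

lemma arc_iff': "arc u v \<longleftrightarrow> u = cross v \<or> u = turn (turn v)"
  unfolding arc_iff by (metis cross_cross turn_turn_turn)

text \<open>The endpoint after the last letter is left out, so
  \<open>list_all2 F cs (trail u cs)\<close> pairs each step with the node it leaves.\<close>

fun trail :: "node \<Rightarrow> bool list \<Rightarrow> node list" where
  "trail u [] = []"
| "trail u (c # cs) = u # trail (step c u) cs"

definition closed_word :: "bool list \<Rightarrow> bool" where
  "closed_word cs \<longleftrightarrow> cs \<noteq> [] \<and> (\<forall>u. fold step cs u = u)"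

text \<open>The third word runs through six triangles with the same turn; the last one is needed only for
  two positions of the exceptional node \<open>t\<close> below.\<close>

lemma closed_words:
  "closed_word [True, True]"
  "closed_word [False, False, False]"
  "closed_word [True, False, False, True, False, False, True, False, False,
     True, False, False, True, False, False, True, False, False]"
  "closed_word [False, True, False, False, True, False, True, False, False, True]"
  by (simp_all add: closed_word_def all_node)

text \<open>Think of \<open>F c u\<close> as: a path uses the arc \<open>(u, step c u)\<close>. The two exceptional nodes are
  those in which the path begins and ends.\<close>

lemma no_spanning_dipath:
  fixes F :: "bool \<Rightarrow> node \<Rightarrow> bool"
  assumes out: "\<forall>u. u \<noteq> s \<and> u \<noteq> t \<longrightarrow> F True u \<noteq> F False u"
    and inn: "\<forall>u. u \<noteq> s \<and> u \<noteq> t \<longrightarrow> F True (cross u) \<noteq> F False (turn (turn u))"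
    and cyc: "\<And>cs. closed_word cs \<Longrightarrow> \<forall>u. list_all2 F cs (trail u cs) \<longrightarrow>
       s \<in> set (trail u cs) \<or> t \<in> set (trail u cs)"
    and s: "s = Node AX False False False"
  shows False
proof -
  note facts =
    closed_words[THEN cyc, unfolded all_node all_bool_eq s, simplified]
    out[unfolded all_node all_bool_eq s, simplified]
    inn[unfolded all_node all_bool_eq s, simplified]
  \<comment> \<open>There are 24 positions of \<open>t\<close>; with \<open>s\<close> fixed, each
    leaves a propositional contradiction in the 48 atoms \<open>F c u\<close>.\<close>
  have "\<forall>u. t \<noteq> u"
    unfolding all_node all_bool_eq
    by (intro conjI; rule notI; insert facts; hypsubst; simp (no_asm_use); sat)
  then show False by blast
qed

section \<open>Blowing up the nodes\<close>

text \<open>Every node is replaced by a complete bipartite graph with \<open>n\<close> vertices in either class, and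
  an arc from \<open>u\<close> to \<open>v\<close> by a single edge between the vertices with index 0 of class \<open>True\<close> over
  \<open>u\<close> and of class \<open>False\<close> over \<open>v\<close>.\<close>

type_synonym vertex = "node \<times> bool \<times> nat"

definition verts :: "nat \<Rightarrow> vertex set" where
  "verts n = UNIV \<times> UNIV \<times> {..<n}"

fun adj :: "nat \<Rightarrow> vertex \<Rightarrow> vertex \<Rightarrow> bool" where
  "adj n (u, c, i) (v, c', i') \<longleftrightarrow> i < n \<and> i' < n \<and> c \<noteq> c' \<and>
     (u = v \<or> i = 0 \<and> i' = 0 \<and> (if c then arc u v else arc v u))"

section \<open>Size, bipartiteness and connectedness of the blow-up\<close>

lemma UNIV_node: "(UNIV :: node set) = (\<lambda>(j, p, q, r). Node j p q r) ` ({AX, AY, AZ} \<times> UNIV)"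
  by (auto simp: image_iff) (metis axis.exhaust node.exhaust)

lemma finite_node: "finite (UNIV :: node set)"
  by (simp add: UNIV_node)

lemma card_node: "card (UNIV :: node set) = 24"
  unfolding UNIV_node
  by (subst card_image) (auto simp: inj_on_def card_cartesian_product simp flip: UNIV_Times_UNIV)

lemma finite_verts: "finite (verts n)"
  by (simp add: verts_def finite_node)

lemma card_verts: "card (verts n) = 48 * n"
  by (simp add: verts_def card_cartesian_product card_node)

lemma adj_iff: "adj n x y \<longleftrightarrow> x \<in> verts n \<and> y \<in> verts n \<and> fst (snd x) \<noteq> fst (snd y) \<and>
    (fst x = fst y \<or> snd (snd x) = 0 \<and> snd (snd y) = 0 \<and>
      (if fst (snd x) then arc (fst x) (fst y) else arc (fst y) (fst x)))"
  by (cases x; cases y) (auto simp: verts_def)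

lemma simple_adj: "simple_graph (verts n) (adj n)"
  unfolding simple_graph_def by (auto simp: finite_verts adj_iff split: if_splits)

lemma bipartite_adj: "bipartite (verts n) (adj n)"
  unfolding bipartite_def
  by (rule exI[of _ "{x \<in> verts n. fst (snd x)}"], rule exI[of _ "{x \<in> verts n. \<not> fst (snd x)}"])
    (auto simp: adj_iff)

text \<open>Strong connectivity of the digraph: turning reaches all three axes at a cube vertex, and
  crossing along an axis flips its coordinate.\<close>

lemma node_set_eq_UNIV:
  fixes S :: "node set"
  assumes "S \<noteq> {}" "\<And>u c. u \<in> S \<Longrightarrow> step c u \<in> S"
  shows "S = UNIV"
proof -
  have c: "cross u \<in> S" and t: "turn u \<in> S" if "u \<in> S" for u
    using assms(2)[OF that, of True] assms(2)[OF that, of False] by simp_all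
  have t': "Node j' p q r \<in> S" if "Node j p q r \<in> S" for j j' p q r
    using t[of "Node AX p q r"] t[of "Node AY p q r"] t[of "Node AZ p q r"] that
    by (cases j; cases j') auto
  have p: "Node AX p' q r \<in> S" if "Node AX p q r \<in> S" for p p' q r
    using c[OF that] that by (cases "p' = p") auto
  have q: "Node AY p q' r \<in> S" if "Node AY p q r \<in> S" for p q q' r
    using c[OF that] that by (cases "q' = q") auto
  have r: "Node AZ p q r' \<in> S" if "Node AZ p q r \<in> S" for p q r r'
    using c[OF that] that by (cases "r' = r") auto
  obtain u where "u \<in> S" using assms(1) by blast
  then have "v \<in> S" for v by (cases u; cases v) (metis t' p q r)
  then show ?thesis by auto
qed

lemma connected_adj:
  assumes "n > 0"
  shows "connected_graph (verts n) (adj n)"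
proof (rule connected_graphI)
  show "verts n \<noteq> {}" using assms by (auto simp: verts_def)
  show "adj n x y \<Longrightarrow> adj n y x" "adj n x y \<Longrightarrow> y \<in> verts n" for x y
    using simple_adj[of n] unfolding simple_graph_def by blast+
  fix S assume S: "S \<subseteq> verts n" "S \<noteq> {}" "\<And>x y. x \<in> S \<Longrightarrow> adj n x y \<Longrightarrow> y \<in> S"
  define T where "T = {u. (u, True, 0) \<in> S}"
  \<comment> \<open>One vertex of a blown-up node yields all of them: the opposite class is adjacent
    to it, and its own class is adjacent to index 0 of the opposite class.\<close>
  have core: "(u, c', j) \<in> S" if "(u, c, i) \<in> S" "j < n" for u c i c' j
  proof -
    have "i < n" using that S(1) by (auto simp: verts_def)
    then have "(u, \<not> c, j) \<in> S" "(u, \<not> c, 0) \<in> S"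
      using S(3)[OF that(1), of "(u, \<not> c, j)"] S(3)[OF that(1), of "(u, \<not> c, 0)"] that(2) assms
      by auto
    moreover have "(u, c, j) \<in> S"
      using S(3)[OF \<open>(u, \<not> c, 0) \<in> S\<close>, of "(u, c, j)"] that(2) assms by auto
    ultimately show ?thesis by (cases "c' = c") auto
  qed
  have "T = UNIV"
  proof (rule node_set_eq_UNIV)
    obtain u c i where "(u, c, i) \<in> S" using S(2) by (metis ex_in_conv surj_pair)
    then have "u \<in> T" using core assms by (simp add: T_def)
    then show "T \<noteq> {}" by blast
    fix u c assume "u \<in> T"
    then have "(step c u, False, 0) \<in> S"
      using S(3)[of "(u, True, 0)" "(step c u, False, 0)"] assms by (auto simp: T_def arc_def)
    then show "step c u \<in> T" using core assms by (auto simp: T_def)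
  qed
  then have "(u, True, 0) \<in> S" for u by (auto simp: T_def)
  then show "S = verts n"
    using S(1) core by (fastforce simp: verts_def)
qed

subsection \<open>Symmetries\<close>

definition dmap :: "(node \<Rightarrow> node) \<Rightarrow> vertex \<Rightarrow> vertex" where
  "dmap g = (\<lambda>(u, c, i). (g u, c, i))"

lemma bij_betw_dmap: "bij g \<Longrightarrow> bij_betw (dmap g) (verts n) (verts n)"
  using bij_betw_map_prod[OF _ bij_betw_id, of g UNIV UNIV "UNIV \<times> {..<n}"]
  by (simp add: dmap_def verts_def map_prod_def id_def case_prod_unfold)

lemma adj_dmap:
  assumes "\<And>u c. g (step c u) = step c (g u)" "adj n x y"
  shows "adj n (dmap g x) (dmap g y)"
proof -
  have "arc u v \<Longrightarrow> arc (g u) (g v)" for u v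
    using assms(1) by (auto simp: arc_def)
  then show ?thesis using assms(2) by (cases x; cases y) (auto simp: dmap_def)
qed

lemma starts_dmap:
  assumes "bij g" "\<And>u c. g (step c u) = step c (g u)" "starts_longest (verts n) (adj n) (u, c, i)"
  shows "starts_longest (verts n) (adj n) (g u, c, i)"
  using starts_longest_bij[OF bij_betw_dmap[OF assms(1)] _ assms(3)] adj_dmap[of g n, OF assms(2)]
  by (simp add: dmap_def)

fun rotate_axes :: "node \<Rightarrow> node" where
  "rotate_axes (Node j p q r) = Node (case j of AX \<Rightarrow> AY | AY \<Rightarrow> AZ | AZ \<Rightarrow> AX) r p q"

fun translate :: "bool \<Rightarrow> bool \<Rightarrow> bool \<Rightarrow> node \<Rightarrow> node" where
  "translate x y z (Node j p q r) = Node j (p \<noteq> x) (q \<noteq> y) (r \<noteq> z)"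

fun reflect :: "node \<Rightarrow> node" where
  "reflect (Node j p q r) = Node (case j of AX \<Rightarrow> AX | AY \<Rightarrow> AZ | AZ \<Rightarrow> AY) p r q"

lemma rotate_axes_step: "rotate_axes (step c u) = step c (rotate_axes u)"
  by (cases u rule: cross.cases; cases c) auto

lemma translate_step: "translate x y z (step c u) = step c (translate x y z u)"
  by (cases u rule: cross.cases; cases c) auto

text \<open>Swapping two axes reverses the sense of every triangle, while the 2-cycles go to
  2-cycles; so the digraph is isomorphic to its reverse.\<close>

lemma arc_reflect: "arc u v \<Longrightarrow> arc (reflect v) (reflect u)"
  unfolding arc_iff by (cases u rule: cross.cases) auto

lemma bij_rotate_axes: "bij rotate_axes"
  by (rule o_bij[of "rotate_axes \<circ> rotate_axes"]) (auto simp: fun_eq_iff all_node)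

lemma bij_translate: "bij (translate x y z)"
  by (rule o_bij[of "translate x y z"]) (auto simp: fun_eq_iff all_node)

text \<open>A power of \<open>rotate_axes\<close> corrects the axis; a translation, which keeps
  axes, then corrects the cube vertex.\<close>

lemma node_transitive:
  obtains g where "bij g" "\<And>u c. g (step c u) = step c (g u)" "g u = v"
proof -
  have "axis_of u = axis_of v \<or> axis_of (rotate_axes u) = axis_of v
      \<or> axis_of (rotate_axes (rotate_axes u)) = axis_of v"
    by (cases u rule: cross.cases; cases v rule: cross.cases) auto
  moreover have "bij (\<lambda>u. rotate_axes (rotate_axes u))"
    using bij_comp[OF bij_rotate_axes bij_rotate_axes] by (simp add: o_def)
  ultimately obtain h where h: "bij h" "\<And>u c. h (step c u) = step c (h u)" "axis_of (h u) = axis_of v"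
    using bij_id[unfolded id_def] bij_rotate_axes rotate_axes_step
    by (elim disjE) (blast, blast, metis)
  obtain x y z where x: "translate x y z (h u) = v"
  proof -
    obtain j p q r j' p' q' r' where hv: "h u = Node j p q r" "v = Node j' p' q' r'"
      by (cases "h u"; cases v)
    then have "translate (p \<noteq> p') (q \<noteq> q') (r \<noteq> r') (h u) = v"
      using h(3) by auto
    then show ?thesis using that by blast
  qed
  show ?thesis
    by (rule that[of "translate x y z \<circ> h"])
      (use h x in \<open>auto simp: translate_step intro: bij_comp bij_translate\<close>)
qed

text \<open>Arc edges run from class \<open>True\<close> to class \<open>False\<close>, so a map
  that reverses arcs becomes an automorphism once it also exchanges the classes.\<close>

lemma starts_reflect:
  assumes "starts_longest (verts n) (adj n) (u, c, i)"
  shows "starts_longest (verts n) (adj n) (reflect u, \<not> c, i)"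
proof -
  define f :: "vertex \<Rightarrow> vertex" where "f = (\<lambda>(u, c, i). (reflect u, \<not> c, i))"
  have "reflect (reflect u) = u" for u by (cases u rule: cross.cases) auto
  then have bij: "bij_betw f (verts n) (verts n)"
    by (intro bij_betw_byWitness[of _ f]) (auto simp: f_def verts_def)
  have "adj n x y \<Longrightarrow> adj n (f x) (f y)" for x y
    using arc_reflect by (cases x; cases y) (auto simp: f_def)
  then have "starts_longest (verts n) (adj n) (f (u, c, i))"
    using starts_longest_bij[OF bij _ assms] by blast
  then show ?thesis by (simp add: f_def)
qed

text \<open>Exchanging the indices \<open>i\<close> and \<open>j\<close> over all nodes fixes index
  0, the only index met by arc edges, and so is an automorphism.\<close>

lemma starts_index:
  assumes "starts_longest (verts n) (adj n) (u, c, i)" "0 < i" "i < n" "0 < j" "j < n"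
  shows "starts_longest (verts n) (adj n) (u, c, j)"
proof -
  define f :: "vertex \<Rightarrow> vertex"
    where "f = (\<lambda>(u, c, k). (u, c, if k = i then j else if k = j then i else k))"
  have bij: "bij_betw f (verts n) (verts n)"
    using assms by (intro bij_betw_byWitness[of _ f]) (auto simp: f_def verts_def)
  have "adj n x y \<Longrightarrow> adj n (f x) (f y)" for x y
    using assms by (cases x; cases y) (auto simp: f_def)
  then have "starts_longest (verts n) (adj n) (f (u, c, i))"
    using starts_longest_bij[OF bij _ assms(1)] by blast
  then show ?thesis by (simp add: f_def)
qed

text \<open>Index, class and node are adjusted in turn, by \<open>starts_index\<close>,
  \<open>starts_reflect\<close> and \<open>node_transitive\<close>.\<close>

lemma starts_same_kind:
  assumes "starts_longest (verts n) (adj n) (u, c, i)" "i < n" "j < n" "i = 0 \<longleftrightarrow> j = 0"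
  shows "starts_longest (verts n) (adj n) (v, c', j)"
proof -
  have j: "starts_longest (verts n) (adj n) (u, c, j)"
    using starts_index[OF assms(1)] assms by (cases "i = 0") auto
  have "\<exists>u. starts_longest (verts n) (adj n) (u, c', j)"
    using j starts_reflect[OF j] by (cases "c = c'") auto
  then obtain u' where u': "starts_longest (verts n) (adj n) (u', c', j)" by blast
  obtain g where "bij g" "\<And>u c. g (step c u) = step c (g u)" "g u' = v"
    using node_transitive[of u' v] by blast
  then show ?thesis using starts_dmap[of g] u' by blast
qed

text \<open>By rotation, the predecessors of the neighbours of a first vertex are first vertices as well;
  as they are distinct, there are too many of them for all to have index 0, or all to have
  positive index.\<close>

lemma all_start_longest:
  assumes n: "3 \<le> n" and x: "x \<in> verts n"
  shows "starts_longest (verts n) (adj n) x"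
proof -
  have "verts n \<noteq> {}" using x by auto
  then obtain p where p: "longest_path (verts n) (adj n) p"
    using longest_path_exists[OF finite_verts] by blast
  then have "hd p \<in> verts n"
    by (auto simp: longest_path_def is_path_def)
  then obtain u c i where "hd p = (u, c, i)" "i < n"
    by (auto simp: verts_def)
  with p have s: "starts_longest (verts n) (adj n) (u, c, i)" "i < n"
    by (auto simp: starts_longest_def)
  obtain f where f: "inj_on f {y. adj n (u, c, i) y}"
    "\<And>y. adj n (u, c, i) y \<Longrightarrow> starts_longest (verts n) (adj n) (f y) \<and> adj n (f y) y"
    using rotation[OF simple_adj s(1)] by blast
  have "\<exists>u' c' i'. starts_longest (verts n) (adj n) (u', c', i') \<and> i' < n \<and> (i' = 0) \<noteq> (i = 0)"
  proof (rule ccontr)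
    assume *: "\<not> ?thesis"
    show False
    proof (cases "i = 0")
      case True
      \<comment> \<open>A vertex of positive index has neighbours only over its own node, and just
        one of them has index 0. Injectivity then fails for \<open>k = 1\<close> and
        \<open>k = 2\<close>, which exist by \<open>3 \<le> n\<close>.\<close>
      have "f (u, \<not> c, k) = (u, c, 0)" if "0 < k" "k < n" for k
      proof -
        obtain u' c' i' where f': "f (u, \<not> c, k) = (u', c', i')" by (cases "f (u, \<not> c, k)")
        then have "starts_longest (verts n) (adj n) (u', c', i')" "adj n (u', c', i') (u, \<not> c, k)"
          using f(2)[of "(u, \<not> c, k)"] that True by auto
        then show ?thesis using * True that f' by auto
      qed
      then have "f (u, \<not> c, 1) = f (u, \<not> c, 2)" using n by simp
      moreover have "adj n (u, c, i) (u, \<not> c, 1)" "adj n (u, c, i) (u, \<not> c, 2)"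
        using n True by auto
      ultimately show False using f(1) by (auto dest: inj_onD)
    next
      case False
      let ?N = "(\<lambda>k. (u, \<not> c, k)) ` {..<n}"
      have N: "?N \<subseteq> {y. adj n (u, c, i) y}" using s(2) by auto
      \<comment> \<open>All \<open>n\<close> neighbours would be sent to the \<open>n - 1\<close>
        vertices of positive index in class \<open>c\<close> over \<open>u\<close>.\<close>
      have "f (u, \<not> c, k) \<in> (\<lambda>k. (u, c, k)) ` {0<..<n}" if "k < n" for k
      proof -
        obtain u' c' i' where f': "f (u, \<not> c, k) = (u', c', i')" by (cases "f (u, \<not> c, k)")
        then have "starts_longest (verts n) (adj n) (u', c', i')" "adj n (u', c', i') (u, \<not> c, k)"
          using f(2)[of "(u, \<not> c, k)"] that s(2) by auto
        then show ?thesis using * False f' by (cases "i' = 0") auto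
      qed
      then have "f ` ?N \<subseteq> (\<lambda>k. (u, c, k)) ` {0<..<n}" by auto
      then have "card (f ` ?N) \<le> card ((\<lambda>k. (u, c, k)) ` {0<..<n})" by (intro card_mono) auto
      also have "\<dots> \<le> n - 1" by (rule order.trans[OF card_image_le]) auto
      finally have "card (f ` ?N) \<le> n - 1" .
      moreover have "card (f ` ?N) = n"
        using inj_on_subset[OF f(1) N] by (simp add: card_image inj_on_def)
      ultimately show False using n by simp
    qed
  qed
  then obtain u' c' i' where s': "starts_longest (verts n) (adj n) (u', c', i')" "i' < n"
    "(i' = 0) \<noteq> (i = 0)" by blast
  obtain v d j where v: "x = (v, d, j)" "j < n" using x by (auto simp: verts_def)
  show ?thesis
    unfolding v using starts_same_kind[OF s, of j v d] starts_same_kind[OF s'(1,2), of j v d] s'(3) v(2)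
    by blast
qed

section \<open>No path meets all blown-up nodes\<close>

text \<open>A path that neither begins nor ends over \<open>z\<close> can visit a vertex with positive index over \<open>z\<close>
  only by entering through one of the two vertices with index 0 and leaving through the other.\<close>

lemma unique_exit:
  assumes p: "is_path (verts n) (adj n) p" and z: "(z, c, k) \<in> set p" "0 < k"
    and ends: "z \<noteq> fst (hd p)" "z \<noteq> fst (last p)"
  shows "\<exists>!y. uses_edge p (z, d, 0) y \<and> fst y \<noteq> z"
proof -
  have pp: "p \<noteq> []" "distinct p" "\<And>i. Suc i < length p \<Longrightarrow> adj n (p ! i) (p ! Suc i)"
    using p by (auto simp: is_path_def)
  obtain m where m: "m < length p" "p ! m = (z, c, k)"
    using z(1) by (metis in_set_conv_nth)
  define out where "out i \<longleftrightarrow> fst (p ! i) \<noteq> z" for i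
  have out0: "out 0" and outl: "out (length p - 1)"
    using ends pp(1) by (auto simp: out_def hd_conv_nth last_conv_nth)
  have outm: "\<not> out m" using m by (simp add: out_def)
  \<comment> \<open>\<open>l\<close> and, below, \<open>r\<close> are the nearest positions before
    and after \<open>m\<close> outside \<open>z\<close>; between them the path stays over
    \<open>z\<close>.\<close>
  define l where "l = (GREATEST i. i \<le> m \<and> out i)"
  have l: "l \<le> m \<and> out l" unfolding l_def
    by (rule GreatestI_nat[of _ 0 m]) (use out0 in auto)
  have l': "\<not> out i" if "l < i" "i \<le> m" for i
    using that Greatest_le_nat[of "\<lambda>i. i \<le> m \<and> out i" i m] by (auto simp: l_def)
  define r where "r = (LEAST i. m \<le> i \<and> out i)"
  have r: "m \<le> r \<and> out r" unfolding r_def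
    by (rule LeastI[of _ "length p - 1"]) (use outl m in auto)
  have rl: "r \<le> length p - 1" unfolding r_def
    by (rule Least_le) (use outl m in auto)
  have r': "\<not> out i" if "m \<le> i" "i < r" for i
    using that not_less_Least[of i "\<lambda>i. m \<le> i \<and> out i"] by (auto simp: r_def)
  have lm: "l < m" "m < r" using l r outm by (auto simp: order.strict_iff_order)
  have terminal: "snd (snd (p ! i)) = 0 \<and> snd (snd (p ! Suc i)) = 0"
    if "Suc i < length p" "out i \<noteq> out (Suc i)" for i
    using pp(3)[OF that(1)] that(2) by (auto simp: adj_iff out_def)
  have a: "snd (snd (p ! Suc l)) = 0" "\<not> out (Suc l)"
    using terminal[of l] l l'[of "Suc l"] lm m(1) by auto
  have b: "snd (snd (p ! (r - 1))) = 0" "\<not> out (r - 1)"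
    using terminal[of "r - 1"] r r'[of "r - 1"] lm rl m(1) by auto
  \<comment> \<open>The vertex at \<open>m\<close> has positive index, so the entry position
    \<open>Suc l\<close> and the exit position \<open>r - 1\<close> lie strictly on either side of
    it. The two vertices there are distinct with index 0, hence of different classes, and one of
    them is \<open>(z, d, 0)\<close>.\<close>
  have "Suc l \<noteq> m" "r - 1 \<noteq> m" using a(1) b(1) m(2) z(2) by auto
  then have lm': "Suc l < m" "m < r - 1" using lm by auto
  have ne: "p ! Suc l \<noteq> p ! (r - 1)"
    using lm' rl pp(2) by (simp add: nth_eq_iff_index_eq)
  obtain e where e: "p ! Suc l = (z, e, 0)"
    using a by (cases "p ! Suc l") (auto simp: out_def)
  obtain e' where e': "p ! (r - 1) = (z, e', 0)"
    using b by (cases "p ! (r - 1)") (auto simp: out_def)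
  show ?thesis
  proof (cases "d = e")
    case True
    have "uses_edge p (z, d, 0) y \<longleftrightarrow> y = p ! l \<or> y = p ! Suc (Suc l)" for y
      using uses_edge_nth[OF pp(2), of "Suc l" y] lm' m(1) True e by auto
    moreover have "fst (p ! l) \<noteq> z" "fst (p ! Suc (Suc l)) = z"
      using l l'[of "Suc (Suc l)"] lm' by (auto simp: out_def)
    ultimately show ?thesis by metis
  next
    case False
    then have "d = e'" using ne e e' by auto
    then have "uses_edge p (z, d, 0) y \<longleftrightarrow> y = p ! (r - 1 - 1) \<or> y = p ! r" for y
      using uses_edge_nth[OF pp(2), of "r - 1" y] lm' rl e' by auto
    moreover have "fst (p ! r) \<noteq> z" "fst (p ! (r - 1 - 1)) = z"
      using r r'[of "r - 1 - 1"] lm' by (auto simp: out_def)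
    ultimately show ?thesis by metis
  qed
qed

section \<open>Trails all of whose arcs are used\<close>

lemma trail_successor:
  "list_all2 F cs (trail u cs) \<Longrightarrow> v \<in> set (trail u cs) \<Longrightarrow>
     \<exists>c. F c v \<and> (step c v \<in> set (trail u cs) \<or> step c v = fold step cs u)"
proof (induction cs arbitrary: u)
  case (Cons c cs)
  then show ?case by (cases cs) fastforce+
qed simp

lemma trail_predecessor:
  "list_all2 F cs (trail u cs) \<Longrightarrow> w \<in> set (trail u cs) \<union> {fold step cs u} \<Longrightarrow> w \<noteq> u \<Longrightarrow>
     \<exists>v \<in> set (trail u cs). \<exists>c. F c v \<and> step c v = w"
proof (induction cs arbitrary: u)
  case (Cons c cs)
  show ?case
  proof (cases "w = step c u")
    case True
    then show ?thesis using Cons.prems by auto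
  next
    case False
    then show ?thesis using Cons.IH[of "step c u"] Cons.prems by auto
  qed
qed simp

text \<open>Only the start node \<open>u\<close> needs care: as the word is closed, \<open>u\<close>
  is the endpoint of the trail with its first step removed.\<close>

lemma trail_closed_predecessor:
  assumes "list_all2 F cs (trail u cs)" "closed_word cs" "w \<in> set (trail u cs)"
  shows "\<exists>v \<in> set (trail u cs). \<exists>c. F c v \<and> step c v = w"
proof (cases "w = u")
  case False
  then show ?thesis using trail_predecessor[OF assms(1)] assms(3) by blast
next
  case True
  obtain c cs' where cs: "cs = c # cs'" using assms(2) by (cases cs) (auto simp: closed_word_def)
  have "fold step cs' (step c u) = u" using assms(2) by (simp add: cs closed_word_def)
  moreover have "u \<noteq> step c u" by (metis step_neq)
  ultimately have "\<exists>v \<in> set (trail (step c u) cs'). \<exists>c. F c v \<and> step c v = u"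
    using trail_predecessor[of F cs' "step c u" u] assms(1) by (auto simp: cs)
  then show ?thesis unfolding cs True by (metis list.set_intros(2) trail.simps(2))
qed

text \<open>If a path met every blown-up node in a positive index, its used arcs would satisfy the
  hypotheses of \<open>no_spanning_dipath\<close>. The start is fixed because that finite check
  fixes \<open>s\<close>.\<close>

lemma missed_node_aux:
  assumes p: "is_path (verts n) (adj n) p" and hd: "fst (hd p) = Node AX False False False"
  shows "\<exists>z. \<forall>c k. 0 < k \<longrightarrow> (z, c, k) \<notin> set p"
proof (rule ccontr)
  assume *: "\<not> ?thesis"
  define s t where "s = fst (hd p)" and "t = fst (last p)"
  have exit: "\<exists>!y. uses_edge p (z, d, 0) y \<and> fst y \<noteq> z" if "z \<noteq> s" "z \<noteq> t" for z d
    using * unique_exit[OF p] that unfolding s_def t_def by blast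
  have adj: "adj n x y" if "uses_edge p x y" for x y
    using uses_edge_adjacent[OF p simple_adj that] .
  \<comment> \<open>The direction in which \<open>p\<close> runs through the edge is ignored: the
    classes of its ends already tell the direction of the arc.\<close>
  define F where "F c u \<longleftrightarrow> uses_edge p (u, True, 0) (step c u, False, 0)" for c u
  have out: "\<exists>!c. F c z" if z: "z \<noteq> s" "z \<noteq> t" for z
  proof -
    obtain y where y: "uses_edge p (z, True, 0) y" "fst y \<noteq> z"
      using exit[OF z] by blast
    then obtain c where c: "y = (step c z, False, 0)"
      using adj[OF y(1)] by (cases y) (auto simp: arc_def)
    have "c' = c" if "F c' z" for c'
    proof -
      have "step c' z = step c z"
        using exit[OF z, of True] y that unfolding F_def c by (metis fst_conv prod.inject step_neq)
      then show ?thesis using cross_neq_turn[of z] by (cases c; cases c') auto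
    qed
    then show ?thesis using y(1) unfolding c F_def by blast
  qed
  have inn: "\<exists>!u. uses_edge p (u, True, 0) (z, False, 0) \<and> u \<noteq> z" if z: "z \<noteq> s" "z \<noteq> t" for z
  proof -
    obtain y where y: "uses_edge p (z, False, 0) y" "fst y \<noteq> z"
      using exit[OF z] by blast
    then obtain u where u: "y = (u, True, 0)"
      using adj[OF y(1)] by (cases y) auto
    show ?thesis
      using exit[OF z, of False] y unfolding u uses_edge_sym[of p "(_, True, _)"]
      by (metis fst_conv prod.inject)
  qed
  show False
  proof (rule no_spanning_dipath[of s t F])
    show "s = Node AX False False False" using hd by (simp add: s_def)
    show "\<forall>u. u \<noteq> s \<and> u \<noteq> t \<longrightarrow> F True u \<noteq> F False u"
      using out by (metis (full_types))
    show "\<forall>u. u \<noteq> s \<and> u \<noteq> t \<longrightarrow> F True (cross u) \<noteq> F False (turn (turn u))"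
    proof (intro allI impI)
      fix z assume "z \<noteq> s \<and> z \<noteq> t"
      then obtain u where u: "uses_edge p (u, True, 0) (z, False, 0)" "u \<noteq> z"
        and uniq: "\<And>v. uses_edge p (v, True, 0) (z, False, 0) \<Longrightarrow> v \<noteq> z \<Longrightarrow> v = u"
        using inn by metis
      have "arc u z" using adj[OF u(1)] u(2) by auto
      then have "u = cross z \<or> u = turn (turn z)" by (simp add: arc_iff')
      moreover have "cross z \<noteq> turn (turn z)" "cross z \<noteq> z" "turn (turn z) \<noteq> z"
        by (cases z rule: cross.cases; simp)+
      moreover have "F True (cross z) \<longleftrightarrow> uses_edge p (cross z, True, 0) (z, False, 0)"
        "F False (turn (turn z)) \<longleftrightarrow> uses_edge p (turn (turn z), True, 0) (z, False, 0)"
        by (simp_all add: F_def)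
      ultimately show "F True (cross z) \<noteq> F False (turn (turn z))"
        using u uniq by metis
    qed
    fix cs assume cs: "closed_word cs"
    show "\<forall>u. list_all2 F cs (trail u cs) \<longrightarrow> s \<in> set (trail u cs) \<or> t \<in> set (trail u cs)"
    proof (intro allI impI, rule ccontr)
      fix u assume F: "list_all2 F cs (trail u cs)"
        and no_end: "\<not> (s \<in> set (trail u cs) \<or> t \<in> set (trail u cs))"
      define C where "C = set (trail u cs)"
      have C: "s \<notin> C" "t \<notin> C" using no_end by (auto simp: C_def)
      have uC: "u \<in> C" using cs by (cases cs) (auto simp: C_def closed_word_def)
      have succ: "\<exists>c. F c v \<and> step c v \<in> C" if "v \<in> C" for v
        using trail_successor[OF F] that uC cs unfolding C_def closed_word_def by metis
      have pred: "\<exists>v\<in>C. \<exists>c. F c v \<and> step c v = w" if "w \<in> C" for w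
        using trail_closed_predecessor[OF F cs] that unfolding C_def by blast
      obtain c k where ck: "(u, c, k) \<in> set p" using * by blast
      \<comment> \<open>\<open>p\<close> starts over \<open>s\<close>, outside \<open>C\<close>, yet
        meets a blown-up node of \<open>C\<close>, so some used edge leaves \<open>C\<close>. But at
        its end \<open>v\<close> in \<open>C\<close> the trail already uses the only out-arc (class
        \<open>True\<close>) or in-arc (class \<open>False\<close>), which stays in
        \<open>C\<close>.\<close>
      obtain x y where "uses_edge p x y" "x \<in> {x. fst x \<in> C}" "y \<notin> {x. fst x \<in> C}"
        by (rule path_leaves_set[of p "{x. fst x \<in> C}" "(u, c, k)"])
          (use ck uC C(1) p in \<open>auto simp: s_def is_path_def\<close>)
      then have xy: "uses_edge p x y" "fst x \<in> C" "fst y \<notin> C" by auto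
      then obtain v d w where x: "x = (v, d, 0)" and y: "y = (w, \<not> d, 0)"
        using adj[OF xy(1)] by (cases x; cases y) auto
      have v: "v \<in> C" "w \<notin> C" "v \<noteq> s" "v \<noteq> t" using xy C by (auto simp: x y)
      show False
      proof (cases d)
        case True
        obtain c where c: "F c v" "step c v \<in> C" using succ[OF v(1)] by blast
        obtain e where e: "\<And>y. uses_edge p (v, True, 0) y \<Longrightarrow> fst y \<noteq> v \<Longrightarrow> y = e"
          using exit[OF v(3,4), of True] by blast
        have "(w, False, 0) = e"
          using xy(1) v(1,2) True by (intro e) (auto simp: x y)
        moreover have "(step c v, False, 0) = e"
          using c(1) by (intro e) (auto simp: F_def)
        ultimately have "w = step c v" by auto
        then show False using c v by simp
      next
        case False
        obtain v' c where c: "v' \<in> C" "F c v'" "step c v' = v" using pred[OF v(1)] by blast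
        have "uses_edge p (w, True, 0) (v, False, 0)" "w \<noteq> v"
          using xy(1) v uses_edge_sym[of p] False by (auto simp: x y)
        moreover have "uses_edge p (v', True, 0) (v, False, 0)" "v' \<noteq> v"
          using c step_neq[of c v'] unfolding F_def by auto
        ultimately show False using inn[OF v(3,4)] c(1) v(2) by blast
      qed
    qed
  qed
qed

text \<open>An automorphism moves the first vertex over the node fixed in
  \<open>missed_node_aux\<close>; the missed node is then pulled back.\<close>

lemma missed_node:
  assumes p: "is_path (verts n) (adj n) p"
  shows "\<exists>z. \<forall>c k. 0 < k \<longrightarrow> (z, c, k) \<notin> set p"
proof -
  obtain g where g: "bij g" "\<And>u c. g (step c u) = step c (g u)"
    "g (fst (hd p)) = Node AX False False False"
    using node_transitive by blast
  have "is_path (verts n) (adj n) (map (dmap g) p)"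
    using is_path_bij[OF bij_betw_dmap[OF g(1)] _ p] adj_dmap[OF g(2)] by blast
  moreover have "fst (hd (map (dmap g) p)) = Node AX False False False"
    using p g(3) by (simp add: is_path_def hd_map dmap_def case_prod_unfold)
  ultimately obtain z where z: "\<forall>c k. 0 < k \<longrightarrow> (z, c, k) \<notin> set (map (dmap g) p)"
    using missed_node_aux by blast
  obtain z' where "z = g z'" using bij_is_surj[OF g(1)] by blast
  then have "dmap g (z', c, k) = (z, c, k)" for c k by (simp add: dmap_def)
  then have "(z', c, k) \<in> set p \<Longrightarrow> (z, c, k) \<in> set (map (dmap g) p)" for c k
    unfolding set_map by (metis imageI)
  then show ?thesis using z by blast
qed

lemma path_length_bound:
  assumes p: "is_path (verts n) (adj n) p"
  shows "length p + 2 * (n - 1) \<le> card (verts n)"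
proof -
  obtain z where z: "\<forall>c k. 0 < k \<longrightarrow> (z, c, k) \<notin> set p"
    using missed_node[OF p] by blast
  \<comment> \<open>Both classes with the indices 1 to \<open>n - 1\<close> over the missed node;
    index 0 may still be visited.\<close>
  define M :: "vertex set" where "M = {z} \<times> UNIV \<times> {0<..<n}"
  have "card M = 2 * (n - 1)" by (simp add: M_def card_cartesian_product)
  moreover have "length p = card (set p)"
    using p by (simp add: is_path_iff distinct_card)
  moreover have "set p \<inter> M = {}" using z by (auto simp: M_def)
  moreover have "set p \<union> M \<subseteq> verts n" using p by (auto simp: M_def is_path_iff verts_def)
  moreover have "finite M" by (simp add: M_def)
  ultimately show ?thesis
    by (metis List.finite_set card_Un_disjoint card_mono finite_verts)
qed

theorem theorem2p25:
  fixes d :: nat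
  assumes "d \<ge> 1"
  shows "\<exists>(V :: nat set) E. simple_graph V E \<and> bipartite V E \<and> connected_graph V E
           \<and> \<not> traceable V E \<and> detour_graph V E \<and> detour_deficiency V E \<ge> d"
proof -
  \<comment> \<open>\<open>all_start_longest\<close> requires \<open>3 \<le> n\<close>, and
    \<open>2 * (n - 1)\<close> must be at least \<open>d\<close> and positive.\<close>
  define n where "n = d + 3"
  let ?V = "verts n" and ?E = "adj n"
  have nontraceable: "\<not> traceable ?V ?E"
  proof
    assume "traceable ?V ?E"
    then obtain p where "is_path ?V ?E p" "set p = ?V" by (auto simp: traceable_def)
    moreover from this have "length p = card ?V"
      by (metis distinct_card is_path_iff)
    ultimately show False using path_length_bound[of n p] by (simp add: n_def)
  qed
  have "?V \<noteq> {}" using connected_adj[of n] by (simp add: n_def connected_graph_def)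
  then obtain p where p: "longest_path ?V ?E p"
    using longest_path_exists[OF finite_verts] by blast
  have deficiency: "detour_deficiency ?V ?E \<ge> d"
  proof -
    have "length p + 2 * (n - 1) \<le> card ?V"
      using path_length_bound p by (simp add: longest_path_def)
    moreover have "d \<le> 2 * (n - 1)" by (simp add: n_def)
    ultimately show ?thesis
      unfolding detour_deficiency_def tau_G_eq_longest[OF finite_verts p] by linarith
  qed
  have detour: "detour_graph ?V ?E"
    using detour_graph_if_all_start[OF finite_verts] all_start_longest[of n] by (auto simp: n_def)
  have inj: "inj (to_nat :: vertex \<Rightarrow> nat)" by simp
  show ?thesis
  proof (intro exI conjI)
    show "simple_graph (to_nat ` ?V) (map_edges to_nat ?E)"
      by (rule simple_graph_image[OF inj simple_adj])
    show "bipartite (to_nat ` ?V) (map_edges to_nat ?E)"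
      by (rule bipartite_image[OF inj bipartite_adj])
    show "connected_graph (to_nat ` ?V) (map_edges to_nat ?E)"
      by (rule connected_image[OF inj connected_adj]) (simp add: n_def)
    show "\<not> traceable (to_nat ` ?V) (map_edges to_nat ?E)"
      using nontraceable traceable_image[OF inj] by blast
    show "detour_graph (to_nat ` ?V) (map_edges to_nat ?E)"
      by (rule detour_graph_image[OF inj detour])
    show "detour_deficiency (to_nat ` ?V) (map_edges to_nat ?E) \<ge> d"
      using deficiency detour_deficiency_image[OF inj] by metis
  qed
qed

end
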